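(* The logic $\mathcal{LB}=\langle\mathbf{Fm},\mathbf C_{\mathcal{LB}}\rangle$ satisfies the following properties (with $\mathbf C=\mathbf C_{\mathcal{LB}}$): for all $\Gamma\cup\{\varphi,\psi\}\subseteq Fm$, (PC) $\mathbf C(\varphi\land\psi)=\mathbf C(\varphi\otimes\psi)=\mathbf C(\varphi,\psi)$; (PDI) $\mathbf C(\Gamma,\varphi\lor\psi)=\mathbf C(\Gamma,\varphi\oplus\psi)=\mathbf C(\Gamma,\varphi)\cap\mathbf C(\Gamma,\psi)$; (PDN) $\mathbf C(\varphi)=\mathbf C(\neg\neg\varphi)$; (PDM) $\mathbf C(\neg(\varphi\land\psi))=\mathbf C(\neg\varphi\lor\neg\psi)$, $\mathbf C(\neg(\varphi\lor\psi))=\mathbf C(\neg\varphi\land\neg\psi)$, $\mathbf C(\neg(\varphi\otimes\psi))=\mathbf C(\neg\varphi\otimes\neg\psi)$, $\mathbf C(\neg(\varphi\oplus\psi))=\mathbf C(\neg\varphi\oplus\neg\psi)$. Moreover, $\mathcal{LB}$ is the only consistent logic $\langle \mathbf{Fm},\mathbf C\rangle$ satisfying (PC), (PDI), (PDN) and (PDM).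
   Context: $\mathbf{Fm}$ is the algebra of formulas (with universe $Fm$) over a countable set of variables in the language $\{\land,\lor,\otimes,\oplus,\neg\}$ ($\land,\lor,\otimes,\oplus$ binary, $\neg$ unary, no constants). A logic is a pair $\langle\mathbf{Fm},\mathbf C\rangle$ where $\mathbf C$ is a structural (substitution-invariant) closure operator on $Fm$; it is consistent if there are $\varphi,\psi\in Fm$ with $\psi\notin\mathbf C(\varphi)$. Notation: $\mathbf C(\Gamma,\varphi)=\mathbf C(\Gamma\cup\{\varphi\})$. $\mathcal{FOUR}$ is the algebra with universe $\{\mathsf f,\bot,\top,\mathsf t\}$ where $\land,\lor$ are meet and join of the lattice order $\leq_t$ with $\mathsf f <_t \bot,\top <_t \mathsf t$ ($\bot,\top$ $\leq_t$-incomparable), $\otimes,\oplus$ are meet and join of the lattice order $\leq_k$ with $\bot <_k \mathsf f,\mathsf t <_k \top$ ($\mathsf f,\mathsf t$ $\leq_k$-incomparable), and $\neg \mathsf f = \mathsf t$, $\neg\mathsf t=\mathsf f$, $\neg\bot=\bot$, $\neg\top=\top$. Let $\mathsf{Tr}=\{\top,\mathsf t\}$. $\mathcal{LB}$ is the logic with $\varphi\in\mathbf C_{\mathcal{LB}}(\Gamma)$ iff for every homomorphism $h:\mathbf{Fm}\to\mathcal{FOUR}$, $h[\Gamma]\subseteq \mathsf{Tr}$ implies $h(\varphi)\in\mathsf{Tr}$. *)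

theory Defs
  imports "HOL-Library.Countable"
begin

record 'a bilat =
  bconj :: "'a \<Rightarrow> 'a \<Rightarrow> 'a"
  bdisj :: "'a \<Rightarrow> 'a \<Rightarrow> 'a"
  btens :: "'a \<Rightarrow> 'a \<Rightarrow> 'a"
  bplus :: "'a \<Rightarrow> 'a \<Rightarrow> 'a"
  bneg :: "'a \<Rightarrow> 'a"

text \<open>The universe of an algebra is its whole carrier type.\<close>

definition homomorphism :: "'a bilat \<Rightarrow> 'b bilat \<Rightarrow> ('a \<Rightarrow> 'b) \<Rightarrow> bool" where
  "homomorphism A B h \<longleftrightarrow>
     (\<forall>x y. h (bconj A x y) = bconj B (h x) (h y)) \<and>
     (\<forall>x y. h (bdisj A x y) = bdisj B (h x) (h y)) \<and>
     (\<forall>x y. h (btens A x y) = btens B (h x) (h y)) \<and>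
     (\<forall>x y. h (bplus A x y) = bplus B (h x) (h y)) \<and>
     (\<forall>x. h (bneg A x) = bneg B (h x))"

datatype 'v fm =
    Var 'v
  | Conj "'v fm" "'v fm"
  | Disj "'v fm" "'v fm"
  | Tens "'v fm" "'v fm"
  | Plus "'v fm" "'v fm"
  | Neg "'v fm"

definition Fm :: "'v fm bilat" where
  "Fm = \<lparr>bconj = Conj, bdisj = Disj, btens = Tens, bplus = Plus, bneg = Neg\<rparr>"

definition closure_op :: "('a set \<Rightarrow> 'a set) \<Rightarrow> bool" where
  "closure_op C \<longleftrightarrow>
     (\<forall>\<Gamma>. \<Gamma> \<subseteq> C \<Gamma>) \<and>
     (\<forall>\<Gamma> \<Delta>. \<Gamma> \<subseteq> \<Delta> \<longrightarrow> C \<Gamma> \<subseteq> C \<Delta>) \<and>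
     (\<forall>\<Gamma>. C (C \<Gamma>) = C \<Gamma>)"

text \<open>Substitutions are the endomorphisms of the formula algebra.\<close>

definition structural :: "('v fm set \<Rightarrow> 'v fm set) \<Rightarrow> bool" where
  "structural C \<longleftrightarrow> (\<forall>\<sigma> \<Gamma>. homomorphism Fm Fm \<sigma> \<longrightarrow> \<sigma> ` C \<Gamma> \<subseteq> C (\<sigma> ` \<Gamma>))"

text \<open>Finitarity is not required.\<close>

definition is_logic :: "('v fm set \<Rightarrow> 'v fm set) \<Rightarrow> bool" where
  "is_logic C \<longleftrightarrow> closure_op C \<and> structural C"

definition consistent :: "('v fm set \<Rightarrow> 'v fm set) \<Rightarrow> bool" where
  "consistent C \<longleftrightarrow> (\<exists>\<phi> \<psi>. \<psi> \<notin> C {\<phi>})"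

datatype four = FF | Bot | Top | TT

definition le_t :: "four \<Rightarrow> four \<Rightarrow> bool" where
  "le_t x y \<longleftrightarrow> x = y \<or> x = FF \<or> y = TT"

definition le_k :: "four \<Rightarrow> four \<Rightarrow> bool" where
  "le_k x y \<longleftrightarrow> x = y \<or> x = Bot \<or> y = Top"

definition meet :: "('a \<Rightarrow> 'a \<Rightarrow> bool) \<Rightarrow> 'a \<Rightarrow> 'a \<Rightarrow> 'a" where
  "meet le x y = (THE z. le z x \<and> le z y \<and> (\<forall>w. le w x \<and> le w y \<longrightarrow> le w z))"

definition join :: "('a \<Rightarrow> 'a \<Rightarrow> bool) \<Rightarrow> 'a \<Rightarrow> 'a \<Rightarrow> 'a" where
  "join le x y = (THE z. le x z \<and> le y z \<and> (\<forall>w. le x w \<and> le y w \<longrightarrow> le z w))"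

primrec neg4 :: "four \<Rightarrow> four" where
  "neg4 FF = TT"
| "neg4 Bot = Bot"
| "neg4 Top = Top"
| "neg4 TT = FF"

definition FOUR :: "four bilat" where
  "FOUR = \<lparr>bconj = meet le_t, bdisj = join le_t, btens = meet le_k, bplus = join le_k,
           bneg = neg4\<rparr>"

lemma meet_eqI:
  assumes "\<And>x y. le x y \<Longrightarrow> le y x \<Longrightarrow> x = y"
    and "le z x" "le z y" "\<And>w. le w x \<Longrightarrow> le w y \<Longrightarrow> le w z"
  shows "meet le x y = z"
  unfolding meet_def by (rule the_equality) (use assms in blast)+

lemma join_eqI:
  assumes "\<And>x y. le x y \<Longrightarrow> le y x \<Longrightarrow> x = y"
    and "le x z" "le y z" "\<And>w. le x w \<Longrightarrow> le y w \<Longrightarrow> le z w"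
  shows "join le x y = z"
  unfolding join_def by (rule the_equality) (use assms in blast)+

text \<open>Both orders are lattices, so the definite descriptions above are well defined here.\<close>

lemma meet_le_t:
  "meet le_t x y = (if le_t x y then x else if le_t y x then y else FF)"
  by (rule meet_eqI) (auto simp: le_t_def)

lemma join_le_t:
  "join le_t x y = (if le_t x y then y else if le_t y x then x else TT)"
  by (rule join_eqI) (auto simp: le_t_def)

lemma meet_le_k:
  "meet le_k x y = (if le_k x y then x else if le_k y x then y else Bot)"
  by (rule meet_eqI) (auto simp: le_k_def)

lemma join_le_k:
  "join le_k x y = (if le_k x y then y else if le_k y x then x else Top)"
  by (rule join_eqI) (auto simp: le_k_def)

lemma lattice_t:
  "class.lattice (meet le_t) le_t (\<lambda>x y. le_t x y \<and> x \<noteq> y) (join le_t)"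
  by unfold_locales (auto simp: meet_le_t join_le_t le_t_def split: if_splits)

lemma lattice_k:
  "class.lattice (meet le_k) le_k (\<lambda>x y. le_k x y \<and> x \<noteq> y) (join le_k)"
  by unfold_locales (auto simp: meet_le_k join_le_k le_k_def split: if_splits)

definition Tr :: "four set" where
  "Tr = {Top, TT}"

definition C_LB :: "'v fm set \<Rightarrow> 'v fm set" where
  "C_LB \<Gamma> = {\<phi>. \<forall>h. homomorphism Fm FOUR h \<longrightarrow> h ` \<Gamma> \<subseteq> Tr \<longrightarrow> h \<phi> \<in> Tr}"

definition PC :: "('v fm set \<Rightarrow> 'v fm set) \<Rightarrow> bool" where
  "PC C \<longleftrightarrow> (\<forall>\<phi> \<psi>. C {Conj \<phi> \<psi>} = C {Tens \<phi> \<psi>} \<and> C {Tens \<phi> \<psi>} = C {\<phi>, \<psi>})"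

definition PDI :: "('v fm set \<Rightarrow> 'v fm set) \<Rightarrow> bool" where
  "PDI C \<longleftrightarrow> (\<forall>\<Gamma> \<phi> \<psi>.
     C (\<Gamma> \<union> {Disj \<phi> \<psi>}) = C (\<Gamma> \<union> {Plus \<phi> \<psi>}) \<and>
     C (\<Gamma> \<union> {Plus \<phi> \<psi>}) = C (\<Gamma> \<union> {\<phi>}) \<inter> C (\<Gamma> \<union> {\<psi>}))"

definition PDN :: "('v fm set \<Rightarrow> 'v fm set) \<Rightarrow> bool" where
  "PDN C \<longleftrightarrow> (\<forall>\<phi>. C {\<phi>} = C {Neg (Neg \<phi>)})"

definition PDM :: "('v fm set \<Rightarrow> 'v fm set) \<Rightarrow> bool" where
  "PDM C \<longleftrightarrow> (\<forall>\<phi> \<psi>.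
     C {Neg (Conj \<phi> \<psi>)} = C {Disj (Neg \<phi>) (Neg \<psi>)} \<and>
     C {Neg (Disj \<phi> \<psi>)} = C {Conj (Neg \<phi>) (Neg \<psi>)} \<and>
     C {Neg (Tens \<phi> \<psi>)} = C {Tens (Neg \<phi>) (Neg \<psi>)} \<and>
     C {Neg (Plus \<phi> \<psi>)} = C {Plus (Neg \<phi>) (Neg \<psi>)})"

end

theory Submission
  imports Defs
begin

text \<open>
  An element x of FOUR is determined by the pair of truth values of x and of the negation of x
  being designated. If C satisfies the four properties, then a set maximal among those from whose
  finite subsets C does not derive \<open>\<phi>\<close> is a prime theory, and such a theory is the set of formulas
  designated by a valuation into FOUR; hence C extends LB. No finitarity of C is needed, because
  only finite subsets of the theory enter.

  Conversely, suppose C derives a rule refuted by a valuation h. For every formula a, the formulas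
  \<open>a \<otimes> \<not>a\<close> and \<open>a \<oplus> \<not>a\<close> generate, up to equivalence in LB, an image of FOUR under a homomorphism
  sending the designated elements to \<open>a \<oplus> \<not>a\<close> and the others to \<open>a \<otimes> \<not>a\<close>. Substituting these
  formulas for the variables according to h turns the rule into a derivation of \<open>\<not>a\<close> from a.
  But in LB \<open>\<not>(a \<or> b)\<close> yields \<open>\<not>b\<close>, so a derives \<open>a \<or> b\<close>, \<open>\<not>(a \<or> b)\<close>, \<open>\<not>b\<close>, \<open>\<not>\<not>b\<close> and finally b.
\<close>

subsection \<open>Valuations into FOUR\<close>

lemma four_eq_iff:
  "x = y \<longleftrightarrow> (x \<in> Tr \<longleftrightarrow> y \<in> Tr) \<and> (neg4 x \<in> Tr \<longleftrightarrow> neg4 y \<in> Tr)"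
  by (cases x; cases y) (auto simp: Tr_def)

lemma in_Tr: "Top \<in> Tr" "TT \<in> Tr" "Bot \<notin> Tr" "FF \<notin> Tr"
  by (simp_all add: Tr_def)

text \<open>Send \<open>x\<close> to the truth values of \<open>x \<in> Tr\<close> and
  \<open>neg4 x \<in> Tr\<close>. Then \<open>le_k\<close> is the componentwise order,
  \<open>le_t\<close> reverses the second component, and \<open>neg4\<close> swaps the two.\<close>

lemma Tr_FOUR [simp]:
  "bconj FOUR x y \<in> Tr \<longleftrightarrow> x \<in> Tr \<and> y \<in> Tr"
  "bdisj FOUR x y \<in> Tr \<longleftrightarrow> x \<in> Tr \<or> y \<in> Tr"
  "btens FOUR x y \<in> Tr \<longleftrightarrow> x \<in> Tr \<and> y \<in> Tr"
  "bplus FOUR x y \<in> Tr \<longleftrightarrow> x \<in> Tr \<or> y \<in> Tr"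
  "neg4 (bconj FOUR x y) \<in> Tr \<longleftrightarrow> neg4 x \<in> Tr \<or> neg4 y \<in> Tr"
  "neg4 (bdisj FOUR x y) \<in> Tr \<longleftrightarrow> neg4 x \<in> Tr \<and> neg4 y \<in> Tr"
  "neg4 (btens FOUR x y) \<in> Tr \<longleftrightarrow> neg4 x \<in> Tr \<and> neg4 y \<in> Tr"
  "neg4 (bplus FOUR x y) \<in> Tr \<longleftrightarrow> neg4 x \<in> Tr \<or> neg4 y \<in> Tr"
  by (cases x; cases y;
      simp add: FOUR_def meet_le_t join_le_t meet_le_k join_le_k le_t_def le_k_def Tr_def)+

lemma neg_FOUR [simp]: "bneg FOUR = neg4"
  by (simp add: FOUR_def)

lemma neg4_neg4 [simp]: "neg4 (neg4 x) = x"
  by (cases x) auto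

lemma homomorphism_FmD:
  assumes "homomorphism Fm A h"
  shows "h (Conj \<phi> \<psi>) = bconj A (h \<phi>) (h \<psi>)"
    and "h (Disj \<phi> \<psi>) = bdisj A (h \<phi>) (h \<psi>)"
    and "h (Tens \<phi> \<psi>) = btens A (h \<phi>) (h \<psi>)"
    and "h (Plus \<phi> \<psi>) = bplus A (h \<phi>) (h \<psi>)"
    and "h (Neg \<phi>) = bneg A (h \<phi>)"
  using assms by (simp_all add: homomorphism_def Fm_def)

lemma homomorphism_comp:
  "homomorphism A B f \<Longrightarrow> homomorphism B D g \<Longrightarrow> homomorphism A D (g \<circ> f)"
  by (simp add: homomorphism_def)

primrec extend :: "'a bilat \<Rightarrow> ('v \<Rightarrow> 'a) \<Rightarrow> 'v fm \<Rightarrow> 'a" where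
  "extend A v (Var p) = v p"
| "extend A v (Conj \<phi> \<psi>) = bconj A (extend A v \<phi>) (extend A v \<psi>)"
| "extend A v (Disj \<phi> \<psi>) = bdisj A (extend A v \<phi>) (extend A v \<psi>)"
| "extend A v (Tens \<phi> \<psi>) = btens A (extend A v \<phi>) (extend A v \<psi>)"
| "extend A v (Plus \<phi> \<psi>) = bplus A (extend A v \<phi>) (extend A v \<psi>)"
| "extend A v (Neg \<phi>) = bneg A (extend A v \<phi>)"

lemma homomorphism_extend: "homomorphism Fm A (extend A v)"
  by (simp add: homomorphism_def Fm_def)

lemma homomorphism_Fm_eqI:
  assumes "homomorphism Fm A g" "homomorphism Fm A h" "\<And>p. g (Var p) = h (Var p)"
  shows "g \<phi> = h \<phi>"
  by (induction \<phi>) (simp_all add: homomorphism_FmD[OF assms(1)] homomorphism_FmD[OF assms(2)] assms(3))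

subsection \<open>Properties of LB\<close>

lemma C_LB_I:
  "(\<And>h. homomorphism Fm FOUR h \<Longrightarrow> h ` \<Gamma> \<subseteq> Tr \<Longrightarrow> h \<phi> \<in> Tr) \<Longrightarrow> \<phi> \<in> C_LB \<Gamma>"
  by (simp add: C_LB_def)

lemma C_LB_D: "\<phi> \<in> C_LB \<Gamma> \<Longrightarrow> homomorphism Fm FOUR h \<Longrightarrow> h ` \<Gamma> \<subseteq> Tr \<Longrightarrow> h \<phi> \<in> Tr"
  by (simp add: C_LB_def)

lemma C_LB_cong:
  assumes "\<And>h. homomorphism Fm FOUR h \<Longrightarrow> h ` \<Gamma> \<subseteq> Tr \<longleftrightarrow> h ` \<Delta> \<subseteq> Tr"
  shows "C_LB \<Gamma> = C_LB \<Delta>"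
  using assms by (auto simp: C_LB_def)

lemma closure_op_C_LB: "closure_op C_LB"
  unfolding closure_op_def C_LB_def by (intro conjI allI; blast)

lemma structural_C_LB: "structural C_LB"
  unfolding structural_def
proof (intro allI impI image_subsetI C_LB_I)
  fix \<sigma> \<Gamma> \<phi> h
  assume "homomorphism Fm Fm \<sigma>" "\<phi> \<in> C_LB \<Gamma>" "homomorphism Fm FOUR h" "h ` \<sigma> ` \<Gamma> \<subseteq> Tr"
  then show "h (\<sigma> \<phi>) \<in> Tr"
    using C_LB_D[of \<phi> \<Gamma> "h \<circ> \<sigma>"] homomorphism_comp[of Fm Fm \<sigma> FOUR h] by (simp add: image_comp)
qed

lemma consistent_C_LB: "consistent C_LB"
proof -
  have "Neg (Var p) \<notin> C_LB {Var p}" for p :: 'a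
    using C_LB_D[of "Neg (Var p)" "{Var p}" "extend FOUR (\<lambda>_. TT)"] homomorphism_extend
    by (auto simp: Tr_def)
  then show ?thesis
    unfolding consistent_def by blast
qed

lemma PC_C_LB: "PC C_LB"
  unfolding PC_def by (intro allI conjI C_LB_cong) (simp_all add: homomorphism_FmD)

lemma PDN_C_LB: "PDN C_LB"
  unfolding PDN_def by (intro allI conjI C_LB_cong) (simp_all add: homomorphism_FmD)

lemma PDM_C_LB: "PDM C_LB"
  unfolding PDM_def by (intro allI conjI C_LB_cong) (simp_all add: homomorphism_FmD)

lemma PDI_C_LB: "PDI C_LB"
  unfolding PDI_def
proof (intro allI conjI)
  fix \<Gamma> :: "'a fm set" and \<phi> \<psi>
  show "C_LB (\<Gamma> \<union> {Disj \<phi> \<psi>}) = C_LB (\<Gamma> \<union> {Plus \<phi> \<psi>})"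
    by (intro C_LB_cong) (simp add: homomorphism_FmD)
  have "\<chi> \<in> C_LB (\<Gamma> \<union> {Plus \<phi> \<psi>}) \<longleftrightarrow> \<chi> \<in> C_LB (\<Gamma> \<union> {\<phi>}) \<inter> C_LB (\<Gamma> \<union> {\<psi>})" for \<chi>
    unfolding C_LB_def by (auto simp: homomorphism_FmD)
  then show "C_LB (\<Gamma> \<union> {Plus \<phi> \<psi>}) = C_LB (\<Gamma> \<union> {\<phi>}) \<inter> C_LB (\<Gamma> \<union> {\<psi>})"
    by blast
qed

subsection \<open>Lindenbaum's lemma for the finitary part of a closure operator\<close>

lemma closure_opD:
  assumes "closure_op C"
  shows closure_op_extensive: "\<Gamma> \<subseteq> C \<Gamma>"
    and closure_op_mono: "\<Gamma> \<subseteq> \<Delta> \<Longrightarrow> C \<Gamma> \<subseteq> C \<Delta>"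
    and closure_op_least: "\<Gamma> \<subseteq> C \<Delta> \<Longrightarrow> C \<Gamma> \<subseteq> C \<Delta>"
proof -
  show "\<Gamma> \<subseteq> C \<Gamma>"
    using assms by (simp add: closure_op_def)
  show mono: "C \<Gamma> \<subseteq> C \<Delta>" if "\<Gamma> \<subseteq> \<Delta>" for \<Gamma> \<Delta>
    using assms that by (simp add: closure_op_def)
  show "C \<Gamma> \<subseteq> C \<Delta>" if "\<Gamma> \<subseteq> C \<Delta>"
    using mono[OF that] assms by (simp add: closure_op_def)
qed

text \<open>Only finite subsets are constrained, and a finite subset of the union of a chain lies in
  one member, so Zorn's lemma applies. The last clause expresses maximality.\<close>

lemma lindenbaum:
  assumes "\<And>S. finite S \<Longrightarrow> S \<subseteq> \<Gamma> \<Longrightarrow> \<phi> \<notin> C S"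
  obtains T where "\<Gamma> \<subseteq> T" "\<And>S. finite S \<Longrightarrow> S \<subseteq> T \<Longrightarrow> \<phi> \<notin> C S"
    "\<And>x. x \<notin> T \<Longrightarrow> \<exists>S. finite S \<and> S \<subseteq> insert x T \<and> \<phi> \<in> C S"
proof -
  let ?A = "{T. \<Gamma> \<subseteq> T \<and> (\<forall>S. finite S \<longrightarrow> S \<subseteq> T \<longrightarrow> \<phi> \<notin> C S)}"
  have "\<exists>M\<in>?A. \<forall>X\<in>?A. M \<subseteq> X \<longrightarrow> X = M"
  proof (rule subset_Zorn_nonempty)
    have "\<Gamma> \<in> ?A" using assms by simp
    then show "?A \<noteq> {}" by (metis empty_iff)
  next
    fix K assume K: "K \<noteq> {}" "subset.chain ?A K"
    have "\<phi> \<notin> C S" if S: "finite S" "S \<subseteq> \<Union>K" for S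
    proof -
      obtain T where T: "T \<in> K" "S \<subseteq> T"
        using finite_subset_Union_chain[OF S K] by blast
      then have "T \<in> ?A" using K(2) unfolding subset.chain_def by (meson subsetD)
      then show ?thesis using S(1) T(2) by simp
    qed
    moreover have "\<Gamma> \<subseteq> \<Union>K"
    proof -
      obtain T where T: "T \<in> K" using K(1) by blast
      then have "T \<in> ?A" using K(2) unfolding subset.chain_def by (meson subsetD)
      then show ?thesis using T by auto
    qed
    ultimately show "\<Union>K \<in> ?A" by simp
  qed
  then obtain T where T: "T \<in> ?A" and max: "\<And>X. X \<in> ?A \<Longrightarrow> T \<subseteq> X \<Longrightarrow> X = T"
    by (elim bexE) simp
  show thesis
  proof (rule that)
    show "\<Gamma> \<subseteq> T" "\<And>S. finite S \<Longrightarrow> S \<subseteq> T \<Longrightarrow> \<phi> \<notin> C S"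
      using T by simp_all
    fix x assume "x \<notin> T"
    then have "insert x T \<notin> ?A" using max[of "insert x T"] by (metis insertI1 subset_insertI)
    moreover have "\<Gamma> \<subseteq> insert x T" using T by auto
    ultimately show "\<exists>S. finite S \<and> S \<subseteq> insert x T \<and> \<phi> \<in> C S" by simp
  qed
qed

text \<open>Primeness comes from PDI. Closure under consequences of finite subsets suffices later,
  since PC, PDN and PDM equate closures of finite sets.\<close>

lemma prime_theory_exists:
  assumes "closure_op C" "PDI C" "\<phi> \<notin> C \<Gamma>"
  obtains T where "\<Gamma> \<subseteq> T" "\<phi> \<notin> T" "\<And>S. finite S \<Longrightarrow> S \<subseteq> T \<Longrightarrow> C S \<subseteq> T"
    "\<And>x y. Disj x y \<in> T \<Longrightarrow> x \<in> T \<or> y \<in> T"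
proof -
  note cl = closure_opD[OF assms(1)]
  have "\<phi> \<notin> C S" if "S \<subseteq> \<Gamma>" for S
    using assms(3) cl(2)[OF that] by blast
  then obtain T where T: "\<Gamma> \<subseteq> T" "\<And>S. finite S \<Longrightarrow> S \<subseteq> T \<Longrightarrow> \<phi> \<notin> C S"
    and max: "\<And>x. x \<notin> T \<Longrightarrow> \<exists>S. finite S \<and> S \<subseteq> insert x T \<and> \<phi> \<in> C S"
    using lindenbaum[of \<Gamma> \<phi> C] by metis
  have refuted: "\<exists>S. finite S \<and> S \<subseteq> T \<and> \<phi> \<in> C (S \<union> {x})" if x: "x \<notin> T" for x
  proof -
    obtain S where S: "finite S" "S \<subseteq> insert x T" "\<phi> \<in> C S" using max[OF x] by metis
    have "\<phi> \<in> C ((S - {x}) \<union> {x})" using S(3) cl(2)[of S "(S - {x}) \<union> {x}"] by blast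
    then show ?thesis using S(1,2) by (intro exI[of _ "S - {x}"]) auto
  qed
  have closed: "C S \<subseteq> T" if S: "finite S" "S \<subseteq> T" for S
  proof (rule subsetI, rule ccontr)
    fix x assume x: "x \<in> C S" "x \<notin> T"
    obtain S' where S': "finite S'" "S' \<subseteq> T" "\<phi> \<in> C (S' \<union> {x})" using refuted[OF x(2)] by metis
    \<comment> \<open>Cut: \<open>x\<close> is replaced by its premises \<open>S\<close>, so a
      finite subset of \<open>T\<close> already derives \<open>\<phi>\<close>.\<close>
    have "S' \<union> {x} \<subseteq> C (S \<union> S')"
      using x(1) cl(1)[of "S \<union> S'"] cl(2)[of S "S \<union> S'"] by blast
    then have "\<phi> \<in> C (S \<union> S')" using S'(3) cl(3)[of "S' \<union> {x}" "S \<union> S'"] by blast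
    then show False using T(2)[of "S \<union> S'"] S S' by simp
  qed
  show thesis
  proof (rule that[OF T(1) _ closed])
    show "\<phi> \<notin> T" using T(2)[of "{\<phi>}"] cl(1)[of "{\<phi>}"] by auto
  next
    fix x y assume xy: "Disj x y \<in> T"
    show "x \<in> T \<or> y \<in> T"
    proof (rule ccontr)
      assume "\<not> (x \<in> T \<or> y \<in> T)"
      then obtain S S' where S: "finite S" "S \<subseteq> T" "\<phi> \<in> C (S \<union> {x})"
        and S': "finite S'" "S' \<subseteq> T" "\<phi> \<in> C (S' \<union> {y})"
        using refuted[of x] refuted[of y] by metis
      \<comment> \<open>Both derivations are weakened to the common context
        \<open>S \<union> S'\<close>, where PDI merges them.\<close>
      have "\<phi> \<in> C (S \<union> S' \<union> {x}) \<inter> C (S \<union> S' \<union> {y})"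
        using S(3) S'(3) cl(2)[of "S \<union> {x}" "S \<union> S' \<union> {x}"] cl(2)[of "S' \<union> {y}" "S \<union> S' \<union> {y}"]
        by blast
      then have "\<phi> \<in> C (S \<union> S' \<union> {Disj x y})"
        using assms(2) unfolding PDI_def by simp
      then show False using T(2)[of "S \<union> S' \<union> {Disj x y}"] S S' xy by simp
    qed
  qed
qed

subsection \<open>Every logic with the four properties extends LB\<close>

lemma C_LB_le:
  assumes cl: "closure_op C" and "PC C" "PDI C" "PDN C" "PDM C"
  shows "C_LB \<Gamma> \<subseteq> C \<Gamma>"
proof (rule subsetI, rule ccontr)
  fix \<phi> assume \<phi>: "\<phi> \<in> C_LB \<Gamma>" "\<phi> \<notin> C \<Gamma>"
  obtain T where T: "\<Gamma> \<subseteq> T" "\<phi> \<notin> T" and closed: "\<And>S. finite S \<Longrightarrow> S \<subseteq> T \<Longrightarrow> C S \<subseteq> T"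
    and prime: "\<And>x y. Disj x y \<in> T \<Longrightarrow> x \<in> T \<or> y \<in> T"
    using prime_theory_exists[OF cl assms(3) \<phi>(2)] by metis
  have incl: "S' \<subseteq> T" if "C S' \<subseteq> C S" "finite S" "S \<subseteq> T" for S S'
    using closed[OF that(2,3)] that(1) closure_op_extensive[OF cl, of S'] by (meson subset_trans)
  \<comment> \<open>This turns equal closures of finite sets into equivalent membership conditions
    on \<open>T\<close>.\<close>
  then have same: "S \<subseteq> T \<longleftrightarrow> S' \<subseteq> T" if "C S = C S'" "finite S" "finite S'" for S S'
    using that incl[of S S'] incl[of S' S] by auto
  have tens: "Tens x y \<in> T \<longleftrightarrow> x \<in> T \<and> y \<in> T" and conj: "Conj x y \<in> T \<longleftrightarrow> x \<in> T \<and> y \<in> T" for x y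
    using same[of "{Tens x y}" "{x, y}"] same[of "{Conj x y}" "{x, y}"] \<open>PC C\<close>
    by (simp_all add: PC_def)
  have pdi: "C {Disj x y} = C {Plus x y}" "C {Plus x y} = C {x} \<inter> C {y}" for x y
    using \<open>PDI C\<close>[unfolded PDI_def, rule_format, of "{}" x y] by simp_all
  have disj: "Disj x y \<in> T \<longleftrightarrow> x \<in> T \<or> y \<in> T" for x y
    using prime[of x y] pdi[of x y] incl[of "{Disj x y}" "{x}"] incl[of "{Disj x y}" "{y}"] by auto
  have plus: "Plus x y \<in> T \<longleftrightarrow> x \<in> T \<or> y \<in> T" for x y
    using same[OF pdi(1), of x y] disj by simp
  have negneg: "Neg (Neg x) \<in> T \<longleftrightarrow> x \<in> T" for x
    using same[of "{x}" "{Neg (Neg x)}"] \<open>PDN C\<close> by (simp add: PDN_def)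
  have neg: "Neg (Conj x y) \<in> T \<longleftrightarrow> Neg x \<in> T \<or> Neg y \<in> T"
    "Neg (Disj x y) \<in> T \<longleftrightarrow> Neg x \<in> T \<and> Neg y \<in> T"
    "Neg (Tens x y) \<in> T \<longleftrightarrow> Neg x \<in> T \<and> Neg y \<in> T"
    "Neg (Plus x y) \<in> T \<longleftrightarrow> Neg x \<in> T \<or> Neg y \<in> T" for x y
    using same[of "{Neg (Conj x y)}" "{Disj (Neg x) (Neg y)}"]
      same[of "{Neg (Disj x y)}" "{Conj (Neg x) (Neg y)}"]
      same[of "{Neg (Tens x y)}" "{Tens (Neg x) (Neg y)}"]
      same[of "{Neg (Plus x y)}" "{Plus (Neg x) (Neg y)}"] \<open>PDM C\<close>
    by (simp_all add: PDM_def conj disj tens plus)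
  \<comment> \<open>Each variable gets the unique element whose two designation bits record whether
    \<open>Var p\<close> and \<open>Neg (Var p)\<close> lie in \<open>T\<close>.\<close>
  define h where "h = extend FOUR (\<lambda>p.
    if Var p \<in> T then (if Neg (Var p) \<in> T then Top else TT)
    else (if Neg (Var p) \<in> T then FF else Bot))"
  \<comment> \<open>The second conjunct strengthens the induction: the case of \<open>Neg\<close>
    needs it, and \<open>negneg\<close> restores it there.\<close>
  have "(h \<psi> \<in> Tr \<longleftrightarrow> \<psi> \<in> T) \<and> (neg4 (h \<psi>) \<in> Tr \<longleftrightarrow> Neg \<psi> \<in> T)" for \<psi>
    unfolding h_def
  proof (induction \<psi>)
    case (Var p)
    then show ?case by (simp add: Tr_def)
  qed (simp_all add: conj disj tens plus neg negneg)
  moreover have "homomorphism Fm FOUR h"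
    unfolding h_def by (rule homomorphism_extend)
  ultimately show False
    using C_LB_D[OF \<phi>(1), of h] T by auto
qed

subsection \<open>LB is maximal\<close>

text \<open>Under a valuation \<open>g\<close>, the map \<open>four_fm a\<close> becomes the
  identity of FOUR if \<open>g a\<close> is \<open>TT\<close> or \<open>FF\<close>, and constantly
  \<open>g a\<close> if \<open>g a\<close> is \<open>Top\<close> or \<open>Bot\<close>.\<close>

fun four_fm :: "'v fm \<Rightarrow> four \<Rightarrow> 'v fm" where
  "four_fm a Bot = Tens a (Neg a)"
| "four_fm a Top = Plus a (Neg a)"
| "four_fm a TT = Disj (Tens a (Neg a)) (Plus a (Neg a))"
| "four_fm a FF = Conj (Tens a (Neg a)) (Plus a (Neg a))"

lemma Tr_four_fm:
  assumes "homomorphism Fm FOUR g"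
  shows "g (four_fm a x) \<in> Tr \<longleftrightarrow>
      (if x \<in> Tr then g a \<in> Tr \<or> neg4 (g a) \<in> Tr else g a \<in> Tr \<and> neg4 (g a) \<in> Tr)"
    and "neg4 (g (four_fm a x)) \<in> Tr \<longleftrightarrow>
      (if neg4 x \<in> Tr then g a \<in> Tr \<or> neg4 (g a) \<in> Tr else g a \<in> Tr \<and> neg4 (g a) \<in> Tr)"
  by (cases x; auto simp: homomorphism_FmD[OF assms] in_Tr)+

text \<open>The map applies one monotone function on truth values to both designation bits. The
  binary operations act on each bit as conjunction or disjunction, and \<open>neg4\<close> swaps the
  bits, so all are preserved.\<close>

lemma homomorphism_four_fm:
  assumes "homomorphism Fm FOUR g"
  shows "homomorphism FOUR FOUR (\<lambda>x. g (four_fm a x))"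
  unfolding homomorphism_def four_eq_iff[of "g _"] by (simp add: Tr_four_fm[OF assms]) blast

lemma negation_derivable_of_refuted_rule:
  assumes C: "is_logic C" and LB: "\<And>\<Gamma>. C_LB \<Gamma> \<subseteq> C \<Gamma>"
    and \<phi>: "\<phi> \<in> C \<Gamma>" "\<phi> \<notin> C_LB \<Gamma>"
  shows "Neg a \<in> C {a}"
proof -
  have cl: "closure_op C" using C by (simp add: is_logic_def)
  obtain h where h: "homomorphism Fm FOUR h" "h ` \<Gamma> \<subseteq> Tr" "h \<phi> \<notin> Tr"
    using \<phi>(2) unfolding C_LB_def by blast
  define \<sigma> where "\<sigma> = extend Fm (\<lambda>p. four_fm a (h (Var p)))"
  have \<sigma>: "homomorphism Fm Fm \<sigma>" unfolding \<sigma>_def by (rule homomorphism_extend)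
  \<comment> \<open>Both sides are homomorphisms in \<open>\<psi>\<close> that agree on
    variables.\<close>
  have eq: "g (\<sigma> \<psi>) = g (four_fm a (h \<psi>))" if g: "homomorphism Fm FOUR g" for g \<psi>
    using homomorphism_Fm_eqI[OF homomorphism_comp[OF \<sigma> g]
        homomorphism_comp[OF h(1) homomorphism_four_fm[OF g, of a]], of \<psi>]
    by (simp add: \<sigma>_def)
  \<comment> \<open>Premises are designated by \<open>h\<close>, so their images are designated
    exactly when \<open>Plus a (Neg a)\<close> is.\<close>
  have "\<sigma> ` \<Gamma> \<subseteq> C_LB {a}"
    using h(2) by (auto intro!: C_LB_I simp: eq Tr_four_fm)
  then have "C (\<sigma> ` \<Gamma>) \<subseteq> C {a}"
    using LB[of "{a}"] by (intro closure_op_least[OF cl]) (rule subset_trans)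
  then have "\<sigma> \<phi> \<in> C {a}"
    using C \<phi>(1) \<sigma> unfolding is_logic_def structural_def by (meson image_eqI subsetD)
  \<comment> \<open>As \<open>h \<phi>\<close> is undesignated, \<open>\<sigma> \<phi>\<close> is
    designated exactly when \<open>Tens a (Neg a)\<close> is.\<close>
  moreover have "Neg a \<in> C_LB {\<sigma> \<phi>}"
    using h(3) by (auto intro!: C_LB_I simp: eq Tr_four_fm homomorphism_FmD)
  ultimately show ?thesis
    using LB[of "{\<sigma> \<phi>}"] closure_op_least[OF cl, of "{\<sigma> \<phi>}" "{a}"] by auto
qed

lemma C_LB_maximal:
  assumes C: "is_logic C" "consistent C" and LB: "\<And>\<Gamma>. C_LB \<Gamma> \<subseteq> C \<Gamma>"
  shows "C \<Gamma> \<subseteq> C_LB \<Gamma>"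
proof (rule ccontr)
  assume "\<not> C \<Gamma> \<subseteq> C_LB \<Gamma>"
  then have neg: "Neg a \<in> C {a}" for a
    using negation_derivable_of_refuted_rule[OF C(1) LB, of _ \<Gamma>] by (meson subsetI)
  have cl: "closure_op C" using C(1) by (simp add: is_logic_def)
  have trans: "y \<in> C {a}" if "x \<in> C {a}" "y \<in> C {x}" for a x y
    using that closure_op_least[OF cl, of "{x}" "{a}"] by auto
  have LB_trans: "y \<in> C {a}" if "x \<in> C {a}" "y \<in> C_LB {x}" for a x y
    using trans[OF that(1)] that(2) LB[of "{x}"] by auto
  have "b \<in> C {a}" for a b
  proof -
    have "a \<in> C {a}" using closure_op_extensive[OF cl, of "{a}"] by simp
    then have "Disj a b \<in> C {a}"
      by (rule LB_trans) (auto intro!: C_LB_I simp: homomorphism_FmD)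
    \<comment> \<open>Negating the disjunction carries the derivation over from \<open>a\<close> to
      the arbitrary \<open>b\<close>.\<close>
    then have "Neg (Disj a b) \<in> C {a}" using neg by (rule trans)
    then have "Neg b \<in> C {a}"
      by (rule LB_trans) (auto intro!: C_LB_I simp: homomorphism_FmD)
    then have "Neg (Neg b) \<in> C {a}" using neg by (rule trans)
    then show ?thesis
      by (rule LB_trans) (auto intro!: C_LB_I simp: homomorphism_FmD)
  qed
  then show False using C(2) by (simp add: consistent_def)
qed

theorem proposition3p3p3:
  shows "is_logic (C_LB :: 'v::countable fm set \<Rightarrow> 'v fm set) \<and> consistent (C_LB :: 'v fm set \<Rightarrow> 'v fm set) \<and>
         PC (C_LB :: 'v fm set \<Rightarrow> 'v fm set) \<and> PDI (C_LB :: 'v fm set \<Rightarrow> 'v fm set) \<and>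
         PDN (C_LB :: 'v fm set \<Rightarrow> 'v fm set) \<and> PDM (C_LB :: 'v fm set \<Rightarrow> 'v fm set) \<and>
         (\<forall>C :: 'v fm set \<Rightarrow> 'v fm set.
            is_logic C \<and> consistent C \<and> PC C \<and> PDI C \<and> PDN C \<and> PDM C \<longrightarrow> C = C_LB)"
proof (intro conjI allI impI)
  show "is_logic (C_LB :: 'v fm set \<Rightarrow> 'v fm set)"
    by (simp add: is_logic_def closure_op_C_LB structural_C_LB)
next
  fix C :: "'v fm set \<Rightarrow> 'v fm set"
  assume C: "is_logic C \<and> consistent C \<and> PC C \<and> PDI C \<and> PDN C \<and> PDM C"
  then have LB: "C_LB \<Gamma> \<subseteq> C \<Gamma>" for \<Gamma>
    by (intro C_LB_le) (simp_all add: is_logic_def)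
  have "C \<Gamma> \<subseteq> C_LB \<Gamma>" for \<Gamma>
    using C LB by (intro C_LB_maximal) simp_all
  with LB show "C = C_LB" by (intro ext subset_antisym)
qed (simp_all add: consistent_C_LB PC_C_LB PDI_C_LB PDN_C_LB PDM_C_LB)

end
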